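(* The following two assertions are equivalent. (A) (Debreu–Glicksberg–Fan) For every Nash game with finitely many players $i=1,\dots,p$, strategy sets $C_i$ and payoff functions $\theta_i$: if for each $i$ the set $C_i$ is compact, convex and non-empty, and the payoff function $\theta_i$ is continuous on $C$ and quasi-concave in $x_i$, then there exists at least one Nash equilibrium. (B) (Morgan–Scalzo) For every Nash game with finitely many players $i=1,\dots,p$, strategy sets $C_i$ and payoff functions $\theta_i$: if for each $i$ the set $C_i$ is compact, convex and non-empty, and the payoff function $\theta_i$ is pseudo-continuous on $C$ and quasi-concave in $x_i$, then there exists at least one Nash equilibrium.
   Context: A Nash game consists of $p$ players; player $i$ has a strategy set $C_i$, a subset of a (real) Hausdorff locally convex topological vector space $E_i$. Put $C=\prod_{i=1}^p C_i$; for $x\in C$ write $x=(x_i,x_{-i})$, where $x_{-i}\in\prod_{j\neq i}C_j$ is the strategy vector of the other players. Player $i$ has a payoff function $\theta_i:C\to\mathbb{R}$. A Nash equilibrium is a vector $\hat x\in C$ such that for every $i$, $\theta_i(\hat x_i,\hat x_{-i})\geq\theta_i(x_i,\hat x_{-i})$ for all $x_i\in C_i$. "$\theta_i$ is quasi-concave in $x_i$" means that for each $x_{-i}$ and $\lambda\in\mathbb{R}$ the set $\{x_i\in C_i:\theta_i(x_i,x_{-i})\geq\lambda\}$ is convex. A function $f:Z\to\mathbb{R}$ on a topological space $Z$ is upper pseudo-continuous if for all $x,y\in Z$ with $f(x)<f(y)$ there is a neighbourhood $V$ of $x$ with $f(x')<f(y)$ for all $x'\in V$; lower pseudo-continuous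 if $-f$ is upper pseudo-continuous; pseudo-continuous if both. *)

theory Defs
  imports "HOL-Analysis.Analysis"
begin

text \<open>
  The players' strategy spaces \<open>E\<^sub>i\<close> may all be different, and games are quantified over inside a
  formula, so a space is not rendered as a type. A Hausdorff locally convex topological vector
  space is a topology \<open>T\<close> whose underlying set \<open>topspace T\<close> is a linear subspace of a real vector
  space type \<open>'e\<close>; the type \<open>'e\<close> supplies only the linear operations and carries no topology of its
  own. Nothing relates the topologies of two players' spaces to each other. Every finite family of
  Hausdorff locally convex spaces arises in this way up to linear homeomorphism: take the algebraic
  direct sum of the family as ambient vector space.
\<close>

definition hausdorff_lctvs :: "'e::real_vector topology \<Rightarrow> bool" where
  "hausdorff_lctvs T \<longleftrightarrow>
     subspace (topspace T) \<and>
     continuous_map (prod_topology T T) T (\<lambda>(x, y). x + y) \<and>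
     continuous_map (prod_topology euclideanreal T) T (\<lambda>(a, x). a *\<^sub>R x) \<and>
     Hausdorff_space T \<and>
     (\<forall>U. openin T U \<and> 0 \<in> U \<longrightarrow> (\<exists>V. openin T V \<and> 0 \<in> V \<and> convex V \<and> V \<subseteq> U))"

text \<open>
  Strategy vectors are extensional functions on \<open>{1..p}\<close>. Values of a payoff \<open>\<theta> i\<close> outside
  \<open>strategies p C\<close> are never used.
\<close>

definition strategies :: "nat \<Rightarrow> (nat \<Rightarrow> 'e set) \<Rightarrow> (nat \<Rightarrow> 'e) set" where
  "strategies p C = (\<Pi>\<^sub>E i\<in>{1..p}. C i)"

definition strategy_topology ::
    "nat \<Rightarrow> (nat \<Rightarrow> 'e topology) \<Rightarrow> (nat \<Rightarrow> 'e set) \<Rightarrow> (nat \<Rightarrow> 'e) topology" where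
  "strategy_topology p E C = product_topology (\<lambda>i. subtopology (E i) (C i)) {1..p}"

definition nash_game ::
    "nat \<Rightarrow> (nat \<Rightarrow> 'e::real_vector topology) \<Rightarrow> (nat \<Rightarrow> 'e set) \<Rightarrow> bool" where
  "nash_game p E C \<longleftrightarrow>
     1 \<le> p \<and> (\<forall>i\<in>{1..p}. hausdorff_lctvs (E i) \<and> C i \<subseteq> topspace (E i))"

definition nash_equilibrium ::
    "nat \<Rightarrow> (nat \<Rightarrow> 'e set) \<Rightarrow> (nat \<Rightarrow> (nat \<Rightarrow> 'e) \<Rightarrow> real) \<Rightarrow> (nat \<Rightarrow> 'e) \<Rightarrow> bool" where
  "nash_equilibrium p C \<theta> x \<longleftrightarrow>
     x \<in> strategies p C \<and> (\<forall>i\<in>{1..p}. \<forall>y\<in>C i. \<theta> i x \<ge> \<theta> i (x(i := y)))"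

text \<open>Here \<open>z\<close> plays the role of \<open>x\<^sub>-\<^sub>i\<close>, and \<open>z(i := y)\<close> that of \<open>(y, x\<^sub>-\<^sub>i)\<close>.\<close>

definition quasi_concave_own ::
    "nat \<Rightarrow> (nat \<Rightarrow> 'e::real_vector set) \<Rightarrow> nat \<Rightarrow> ((nat \<Rightarrow> 'e) \<Rightarrow> real) \<Rightarrow> bool" where
  "quasi_concave_own p C i f \<longleftrightarrow>
     (\<forall>z\<in>(\<Pi>\<^sub>E j\<in>{1..p} - {i}. C j). \<forall>c::real. convex {y \<in> C i. f (z(i := y)) \<ge> c})"

definition upper_pseudo_continuous :: "'z topology \<Rightarrow> ('z \<Rightarrow> real) \<Rightarrow> bool" where
  "upper_pseudo_continuous Z f \<longleftrightarrow>
     (\<forall>x\<in>topspace Z. \<forall>y\<in>topspace Z. f x < f y \<longrightarrow>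
        (\<exists>V. openin Z V \<and> x \<in> V \<and> (\<forall>x'\<in>V. f x' < f y)))"

definition lower_pseudo_continuous :: "'z topology \<Rightarrow> ('z \<Rightarrow> real) \<Rightarrow> bool" where
  "lower_pseudo_continuous Z f \<longleftrightarrow> upper_pseudo_continuous Z (\<lambda>x. - f x)"

definition pseudo_continuous :: "'z topology \<Rightarrow> ('z \<Rightarrow> real) \<Rightarrow> bool" where
  "pseudo_continuous Z f \<longleftrightarrow> upper_pseudo_continuous Z f \<and> lower_pseudo_continuous Z f"

end

theory Submission
  imports Defs
begin

text \<open>
  A continuous payoff is pseudo-continuous, so only the step from continuous to pseudo-continuous
  payoffs has content. It rests on the fact that nothing in a Nash game depends on more than the
  order of the payoff values: composing each payoff \<open>\<theta> i\<close> with a function \<open>g i\<close> that is strictly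
  increasing on its range changes neither the equilibria (\<open>nash_equilibrium_transform\<close>) nor
  quasi-concavity (\<open>quasi_concave_own_transform\<close>). So it suffices that a pseudo-continuous payoff
  becomes continuous after such a change of scale, which is
  \<open>pseudo_continuous_imp_continuous_transform\<close>.

  Let \<open>f\<close> be pseudo-continuous on the space \<open>Z\<close> of strategy vectors. Pseudo-continuity says that
  \<open>{f < s}\<close> and \<open>{f > s}\<close> are open for each \<open>s\<close> in the range \<open>S\<close> of \<open>f\<close>, but not for other real
  \<open>s\<close>: this is continuity for the order topology of \<open>S\<close>, and \<open>f\<close> itself may jump across gaps of
  \<open>S\<close>. As \<open>Z\<close> is connected, \<open>S\<close> is densely ordered; as \<open>Z\<close> is compact, \<open>S\<close> has a least and a
  greatest element. A densely ordered set of reals with end points can be mapped into \<open>[0, 1]\<close> by a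
  strictly increasing \<open>g\<close> with dense range (\<open>dense_order_embedding\<close>), which closes the gaps. Between
  any value of \<open>g \<circ> f\<close> and any other number in \<open>[0, 1]\<close> there is then another value of \<open>g \<circ> f\<close>,
  and the open sets given by pseudo-continuity show that \<open>g \<circ> f\<close> is continuous.
\<close>

section \<open>Closing the gaps of a densely ordered set of reals\<close>

text \<open>
  The \<open>n\<close>-th generation of points obtained from \<open>a < b\<close> by inserting a point \<open>h x y\<close> between any
  two neighbours \<open>x < y\<close>. Generation \<open>n\<close> is indexed by \<open>k \<le> 2 ^ n\<close>, and its \<open>k\<close>-th point will be
  sent to the dyadic rational \<open>k / 2 ^ n\<close>.
\<close>

fun subdivision :: "(real \<Rightarrow> real \<Rightarrow> real) \<Rightarrow> real \<Rightarrow> real \<Rightarrow> nat \<Rightarrow> nat \<Rightarrow> real" where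
  "subdivision h a b 0 k = (if k = 0 then a else b)"
| "subdivision h a b (Suc n) k =
     (if even k then subdivision h a b n (k div 2)
      else h (subdivision h a b n (k div 2)) (subdivision h a b n (Suc (k div 2))))"

lemma subdivision_refine: "subdivision h a b (n + j) (k * 2 ^ j) = subdivision h a b n k"
proof (induction j)
  case (Suc j)
  have "k * 2 ^ Suc j = 2 * (k * 2 ^ j)" by simp
  then show ?case using Suc by (simp only: add_Suc_right subdivision.simps) simp
qed simp

lemma subdivision_step:
  assumes h: "\<And>x y. x \<in> S \<Longrightarrow> y \<in> S \<Longrightarrow> x < y \<Longrightarrow> h x y \<in> S \<and> x < h x y \<and> h x y < y"
    and "a \<in> S" "b \<in> S" "a < b" and "k < 2 ^ n"
  shows "subdivision h a b n k \<in> S \<and> subdivision h a b n (Suc k) \<in> S \<and>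
    subdivision h a b n k < subdivision h a b n (Suc k)"
  using \<open>k < 2 ^ n\<close>
proof (induction n arbitrary: k)
  case 0
  then show ?case using assms by auto
next
  case (Suc n)
  define l where "l = k div 2"
  have l: "l < 2 ^ n" using Suc.prems by (auto simp: l_def)
  note IH = Suc.IH[OF l]
  show ?case
  proof (cases "even k")
    case True
    then have "k div 2 = l" "Suc k div 2 = l" by (auto simp: l_def)
    then show ?thesis using True IH h by auto
  next
    case False
    then have "k div 2 = l" "Suc k div 2 = Suc l" by (auto simp: l_def)
    then show ?thesis using False IH h by auto
  qed
qed

text \<open>
  The order of two points from different generations is read off in a common later generation,
  where both indices have been rescaled and the points are strictly increasing in the index.
\<close>

lemma subdivision_le_iff:
  assumes h: "\<And>x y. x \<in> S \<Longrightarrow> y \<in> S \<Longrightarrow> x < y \<Longrightarrow> h x y \<in> S \<and> x < h x y \<and> h x y < y"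
    and ab: "a \<in> S" "b \<in> S" "a < b" and j: "j \<le> 2 ^ n" and k: "k \<le> 2 ^ m"
  shows "subdivision h a b n j \<le> subdivision h a b m k \<longleftrightarrow>
    real j / 2 ^ n \<le> real k / 2 ^ m"
proof -
  let ?R = "subdivision h a b"
  have mono: "?R N i < ?R N i'" if "i < i'" "i' \<le> 2 ^ N" for N i i'
    using that
  proof (induction i' rule: nat_induct)
    case (Suc i')
    have "?R N i' < ?R N (Suc i')"
      using subdivision_step[OF h ab, where n = N and k = i'] Suc.prems by auto
    then show ?case using Suc by (cases "i = i'") auto
  qed simp
  have le: "?R N i \<le> ?R N i' \<longleftrightarrow> i \<le> i'" if "i \<le> 2 ^ N" "i' \<le> 2 ^ N" for N i i'
    using mono[of i i' N] mono[of i' i N] that by (cases i i' rule: linorder_cases) auto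
  have "j * 2 ^ m \<le> 2 ^ (n + m)" "k * 2 ^ n \<le> 2 ^ (n + m)"
    using j k by (auto simp: power_add mult.commute)
  then have "?R (n + m) (j * 2 ^ m) \<le> ?R (n + m) (k * 2 ^ n) \<longleftrightarrow> j * 2 ^ m \<le> k * 2 ^ n"
    by (rule le)
  moreover have "?R (n + m) (j * 2 ^ m) = ?R n j" by (rule subdivision_refine)
  moreover have "?R (n + m) (k * 2 ^ n) = ?R m k"
    using subdivision_refine[of h a b m n k] by (simp add: add.commute)
  moreover have "j * 2 ^ m \<le> k * 2 ^ n \<longleftrightarrow> real j * 2 ^ m \<le> real k * 2 ^ n"
    unfolding of_nat_le_iff[where 'a = real, symmetric] by simp
  moreover have "real j * 2 ^ m \<le> real k * 2 ^ n \<longleftrightarrow> real j / 2 ^ n \<le> real k / 2 ^ m"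
    by (simp add: divide_le_eq pos_le_divide_eq mult.commute)
  ultimately show ?thesis by simp
qed

text \<open>
  The subdivision must not leave out any part of \<open>S\<close>. The midpoint of \<open>x\<close> and \<open>y\<close> may lie in a gap
  of \<open>S\<close>, so the point chosen is one whose distance to the nearer end is at least half of what is
  possible within \<open>S\<close>; the factor accounts for a supremum that is not attained.
\<close>

lemma central_point_exists:
  fixes S :: "real set"
  assumes "\<exists>t\<in>S. x < t \<and> t < y"
  shows "\<exists>c\<in>S. x < c \<and> c < y \<and>
    (\<forall>t\<in>S. x < t \<and> t < y \<longrightarrow> min (t - x) (y - t) \<le> 2 * min (c - x) (y - c))"
proof -
  define T where "T = {t \<in> S. x < t \<and> t < y}"
  define d where "d t = min (t - x) (y - t)" for t
  obtain t0 where t0: "t0 \<in> T" using assms by (auto simp: T_def)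
  have bdd: "bdd_above (d ` T)"
    by (rule bdd_aboveI[where M = "y - x"]) (auto simp: T_def d_def)
  have "d t0 > 0" using t0 by (auto simp: T_def d_def)
  moreover have "d t0 \<le> Sup (d ` T)" using t0 bdd by (intro cSup_upper) auto
  ultimately have "Sup (d ` T) / 2 < Sup (d ` T)" by linarith
  then obtain c where c: "c \<in> T" "Sup (d ` T) / 2 < d c"
    using less_cSup_iff[OF _ bdd, of "Sup (d ` T) / 2"] t0 by blast
  have "d t \<le> 2 * d c" if "t \<in> T" for t
  proof -
    have "d t \<le> Sup (d ` T)" using that bdd by (intro cSup_upper) auto
    then show ?thesis using c(2) by linarith
  qed
  then show ?thesis using c(1) unfolding T_def d_def by blast
qed

text \<open>
  If no subdivision point fell into \<open>[s, s']\<close>, each generation would have a cell around this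
  interval. The point \<open>t\<close> of \<open>S\<close> has distance at least \<open>d = min (t - s) (s' - t) > 0\<close> from both
  ends of such a cell, so the central choice cuts off at least \<open>d / 2\<close> on either side. The cells
  would shrink by this fixed amount each time, which cannot go on forever.
\<close>

lemma subdivision_separates:
  assumes h: "\<And>x y. x \<in> S \<Longrightarrow> y \<in> S \<Longrightarrow> x < y \<Longrightarrow> h x y \<in> S \<and> x < h x y \<and> h x y < y"
    and central: "\<And>x y t. x \<in> S \<Longrightarrow> y \<in> S \<Longrightarrow> t \<in> S \<Longrightarrow> x < t \<Longrightarrow> t < y \<Longrightarrow>
      min (t - x) (y - t) \<le> 2 * min (h x y - x) (y - h x y)"
    and ab: "a \<in> S" "b \<in> S" "a < b"
    and st: "a \<le> s" "s < t" "t < s'" "s' \<le> b" "t \<in> S"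
  shows "\<exists>n k. k \<le> 2 ^ n \<and> s \<le> subdivision h a b n k \<and> subdivision h a b n k \<le> s'"
proof (rule ccontr)
  let ?R = "subdivision h a b"
  assume "\<not> ?thesis"
  then have out: "?R n k < s \<or> s' < ?R n k" if "k \<le> 2 ^ n" for n k
    using that by fastforce
  define d where "d = min (t - s) (s' - t)"
  have d: "d > 0" using st by (auto simp: d_def)
  have "\<exists>k < 2 ^ n. ?R n k < s \<and> s' < ?R n (Suc k) \<and>
      ?R n (Suc k) - ?R n k \<le> (b - a) - real n * (d / 2)" for n
  proof (induction n)
    case 0
    have "a < s \<or> s' < a" "b < s \<or> s' < b" using out[of 0 0] out[of 1 0] by auto
    then show ?case using st by auto
  next
    case (Suc n)
    then obtain k where k: "k < 2 ^ n" "?R n k < s" "s' < ?R n (Suc k)"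
      and len: "?R n (Suc k) - ?R n k \<le> (b - a) - real n * (d / 2)" by blast
    let ?x = "?R n k" and ?y = "?R n (Suc k)"
    have xy: "?x \<in> S" "?y \<in> S" using subdivision_step[OF h ab k(1)] by auto
    have "min (t - ?x) (?y - t) \<le> 2 * min (h ?x ?y - ?x) (?y - h ?x ?y)"
      using xy k st by (intro central) auto
    moreover have "d \<le> min (t - ?x) (?y - t)" using k by (auto simp: d_def min_def)
    ultimately have "d \<le> 2 * min (h ?x ?y - ?x) (?y - h ?x ?y)" by (rule order_trans[rotated])
    then have cut: "d / 2 \<le> h ?x ?y - ?x" "d / 2 \<le> ?y - h ?x ?y"
      by (auto simp: min_def split: if_splits)
    have "(b - a) - real (Suc n) * (d / 2) = ((b - a) - real n * (d / 2)) - d / 2"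
      by (simp add: field_simps)
    then have len': "?y - h ?x ?y \<le> (b - a) - real (Suc n) * (d / 2)"
      "h ?x ?y - ?x \<le> (b - a) - real (Suc n) * (d / 2)" using len cut by linarith+
    have R: "?R (Suc n) (2 * k) = ?x" "?R (Suc n) (Suc (2 * k)) = h ?x ?y"
      "?R (Suc n) (Suc (Suc (2 * k))) = ?y" by auto
    have "h ?x ?y < s \<or> s' < h ?x ?y"
      using out[of "Suc (2 * k)" "Suc n"] k(1) R(2) by simp
    then show ?case
    proof
      assume "h ?x ?y < s"
      then show ?thesis using k len' R
        by (intro exI[of _ "Suc (2 * k)"]) (auto simp del: subdivision.simps)
    next
      assume "s' < h ?x ?y"
      then show ?thesis using k len' R
        by (intro exI[of _ "2 * k"]) (auto simp del: subdivision.simps)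
    qed
  qed
  then have "s' - s < (b - a) - real n * (d / 2)" for n
    by (smt (verit))
  moreover obtain n where "real n * (d / 2) > b - a"
    using reals_Archimedean3[of "d / 2"] d by (metis half_gt_zero)
  ultimately show False using st by (smt (verit))
qed

text \<open>
  The map \<open>g\<close> extends the assignment of \<open>k / 2 ^ n\<close> to the \<open>k\<close>-th point of generation \<open>n\<close>, much as
  the Cantor function does. All dyadic rationals in \<open>[0, 1]\<close> are values, so the range is dense; the subdivision
  points separate the elements of \<open>S\<close>, so \<open>g\<close> is strictly increasing.
\<close>

lemma dense_order_embedding:
  fixes S :: "real set"
  assumes dense: "\<And>x y. x \<in> S \<Longrightarrow> y \<in> S \<Longrightarrow> x < y \<Longrightarrow> \<exists>t\<in>S. x < t \<and> t < y"
    and ab: "a \<in> S" "b \<in> S" "a < b" and S: "S \<subseteq> {a..b}"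
  obtains g :: "real \<Rightarrow> real" where "strict_mono_on S g" "g ` S \<subseteq> {0..1}"
    "\<And>x y. 0 \<le> x \<Longrightarrow> x < y \<Longrightarrow> y \<le> 1 \<Longrightarrow> \<exists>s\<in>S. x < g s \<and> g s < y"
proof -
  have "\<forall>x y. \<exists>c. x \<in> S \<and> y \<in> S \<and> x < y \<longrightarrow> c \<in> S \<and> x < c \<and> c < y \<and>
      (\<forall>t\<in>S. x < t \<and> t < y \<longrightarrow> min (t - x) (y - t) \<le> 2 * min (c - x) (y - c))"
    using central_point_exists dense by metis
  then obtain h where h': "\<And>x y. x \<in> S \<Longrightarrow> y \<in> S \<Longrightarrow> x < y \<Longrightarrow> h x y \<in> S \<and> x < h x y \<and> h x y < y \<and>
      (\<forall>t\<in>S. x < t \<and> t < y \<longrightarrow> min (t - x) (y - t) \<le> 2 * min (h x y - x) (y - h x y))"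
    by metis
  then have h: "h x y \<in> S \<and> x < h x y \<and> h x y < y" if "x \<in> S" "y \<in> S" "x < y" for x y
    using that by blast
  have central: "min (t - x) (y - t) \<le> 2 * min (h x y - x) (y - h x y)"
    if "x \<in> S" "y \<in> S" "t \<in> S" "x < t" "t < y" for x y t
    using h'[of x y] that by auto
  let ?R = "subdivision h a b"
  define Q where "Q s = {real k / 2 ^ n | k n. k \<le> 2 ^ n \<and> ?R n k \<le> s}" for s
  define g where "g s = Sup (Q s)" for s
  have le_iff: "?R n j \<le> ?R m k \<longleftrightarrow> real j / 2 ^ n \<le> real k / 2 ^ m"
    if "j \<le> 2 ^ n" "k \<le> 2 ^ m" for n m j k
    using h ab that by (rule subdivision_le_iff)
  have R_S: "?R n k \<in> S" if "k \<le> 2 ^ n" for n k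
  proof (cases "k < 2 ^ n")
    case True
    then show ?thesis using subdivision_step[OF h ab] by blast
  next
    case False
    then have "?R n k = ?R 0 1" using that subdivision_refine[of h a b 0 n 1] by simp
    then show ?thesis using ab by simp
  qed
  have "real k / 2 ^ n \<le> 1" if "k \<le> 2 ^ n" for k n :: nat
    using of_nat_mono[where 'a = real, OF that] by simp
  then have Q01: "Q s \<subseteq> {0..1}" for s by (auto simp: Q_def)
  then have bdd: "bdd_above (Q s)" for s by (meson bdd_above_Icc bdd_above_mono)
  have Q0: "0 \<in> Q s" if "s \<in> S" for s
    using that S unfolding Q_def by (auto intro!: exI[of _ 0])
  have gR: "g (?R n k) = real k / 2 ^ n" if "k \<le> 2 ^ n" for n k
    unfolding g_def Q_def using that le_iff by (intro cSup_eq_maximum) blast+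
  have g_mono: "g s \<le> g t" if "s \<in> S" "s \<le> t" for s t
  proof -
    have "Q s \<subseteq> Q t" unfolding Q_def using \<open>s \<le> t\<close> order_trans by blast
    then show ?thesis unfolding g_def using Q0[OF that(1)] bdd by (intro cSup_subset_mono) auto
  qed
  show thesis
  proof
    show "strict_mono_on S g"
    proof (rule strict_mono_onI)
      fix s s' assume s: "s \<in> S" "s' \<in> S" "s < s'"
      \<comment> \<open>A single subdivision point in \<open>[s, s']\<close> would only give \<open>g s \<le> g s'\<close>; one in
        \<open>[s, t]\<close> and another in \<open>[w, s']\<close> with \<open>t < w\<close> have different values between them.\<close>
      obtain t where t: "t \<in> S" "s < t" "t < s'" using dense[OF s] by blast
      obtain u where u: "u \<in> S" "s < u" "u < t" using dense[OF s(1) t(1,2)] by blast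
      obtain v where v: "v \<in> S" "t < v" "v < s'" using dense[OF t(1) s(2) t(3)] by blast
      obtain w where w: "w \<in> S" "t < w" "w < v" using dense[OF t(1) v(1,2)] by blast
      have bds: "a \<le> s" "t \<le> b" "a \<le> w" "s' \<le> b" using s t w S by auto
      obtain n k where k: "k \<le> 2 ^ n" "s \<le> ?R n k" "?R n k \<le> t"
        using subdivision_separates[OF h central ab bds(1) u(2,3) bds(2) u(1)] by blast
      obtain m l where l: "l \<le> 2 ^ m" "w \<le> ?R m l" "?R m l \<le> s'"
        using subdivision_separates[OF h central ab bds(3) w(3) v(3) bds(4) v(1)] by blast
      have "g s \<le> real k / 2 ^ n" using g_mono[OF s(1) k(2)] gR k by simp
      also have "\<not> ?R m l \<le> ?R n k" using k l w by linarith
      then have "real k / 2 ^ n < real l / 2 ^ m" using le_iff[OF l(1) k(1)] by linarith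
      also have "\<dots> \<le> g s'" using g_mono[OF R_S l(3)] gR l by simp
      finally show "g s < g s'" .
    qed
    show "g ` S \<subseteq> {0..1}"
    proof safe
      fix s assume "s \<in> S"
      then have "0 \<le> g s" unfolding g_def using Q0 bdd by (intro cSup_upper)
      moreover have "g s \<le> 1" unfolding g_def using Q0[OF \<open>s \<in> S\<close>] Q01[of s]
        by (intro cSup_least) auto
      ultimately show "g s \<in> {0..1}" by simp
    qed
    fix x y :: real assume x: "0 \<le> x" "x < y" "y \<le> 1"
    obtain n where "1 / (y - x) < 2 ^ n" using real_arch_pow[of 2] by auto
    then have n: "1 < 2 ^ n * (y - x)" using x by (simp add: field_simps)
    define k where "k = nat \<lfloor>2 ^ n * x\<rfloor> + 1"
    have "real (nat \<lfloor>2 ^ n * x\<rfloor>) = of_int \<lfloor>2 ^ n * x\<rfloor>" using x by simp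
    then have k: "2 ^ n * x < real k" "real k \<le> 2 ^ n * x + 1" unfolding k_def by linarith+
    then have "real k < 2 ^ n * y" using n by (simp add: algebra_simps)
    then have xy: "x < real k / 2 ^ n" "real k / 2 ^ n < y" using k by (auto simp: field_simps)
    then have "real k / 2 ^ n < 1" using x(3) by linarith
    then have "real k < real (2 ^ n)" by (simp add: divide_less_eq)
    then have "k \<le> 2 ^ n" by (simp only: of_nat_less_iff)
    then show "\<exists>s\<in>S. x < g s \<and> g s < y" using xy gR R_S by metis
  qed
qed

section \<open>Pseudo-continuous functions up to a change of scale\<close>

lemma openin_pseudo_lower:
  assumes "upper_pseudo_continuous Z f" "y \<in> topspace Z"
  shows "openin Z {x \<in> topspace Z. f x < f y}"
proof (subst openin_subopen, safe)
  fix x assume "x \<in> topspace Z" "f x < f y"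
  then obtain V where "openin Z V" "x \<in> V" "\<forall>x'\<in>V. f x' < f y"
    using assms unfolding upper_pseudo_continuous_def by blast
  then show "\<exists>T. openin Z T \<and> x \<in> T \<and> T \<subseteq> {x \<in> topspace Z. f x < f y}"
    using openin_subset by (intro exI[of _ V]) blast
qed

lemma openin_pseudo_upper:
  assumes "lower_pseudo_continuous Z f" "y \<in> topspace Z"
  shows "openin Z {x \<in> topspace Z. f x > f y}"
  using openin_pseudo_lower[of Z "\<lambda>x. - f x" y] assms
  by (simp add: lower_pseudo_continuous_def)

text \<open>
  If there were no maximum, the open sets \<open>{f < f y}\<close> would cover \<open>Z\<close>; but a finite number of them
  misses the point \<open>y\<close> with the largest value among their indices.
\<close>

lemma upper_pseudo_continuous_attains_max:
  assumes f: "upper_pseudo_continuous Z f" and Z: "compact_space Z" "topspace Z \<noteq> {}"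
  shows "\<exists>y\<in>topspace Z. \<forall>x\<in>topspace Z. f x \<le> f y"
proof (rule ccontr)
  assume no: "\<not> ?thesis"
  let ?U = "\<lambda>y. {x \<in> topspace Z. f x < f y}"
  have "\<forall>U\<in>?U ` topspace Z. openin Z U" using openin_pseudo_lower[OF f] by blast
  moreover have "topspace Z \<subseteq> \<Union> (?U ` topspace Z)" using no by (fastforce simp: not_le)
  ultimately obtain \<F> where "finite \<F>" "\<F> \<subseteq> ?U ` topspace Z" "topspace Z \<subseteq> \<Union> \<F>"
    using Z(1) unfolding compact_space_alt by meson
  then obtain Y where "finite Y" "\<F> = ?U ` Y" "Y \<subseteq> topspace Z"
    using finite_subset_image by meson
  then have Y: "Y \<subseteq> topspace Z" "finite Y" "topspace Z \<subseteq> (\<Union>y\<in>Y. ?U y)"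
    using \<open>topspace Z \<subseteq> \<Union> \<F>\<close> by blast+
  then have "Y \<noteq> {}" using Z(2) by auto
  with Y(2) have "Max (f ` Y) \<in> f ` Y" "\<forall>x\<in>Y. f x \<le> Max (f ` Y)" by auto
  then obtain y where "y \<in> Y" "\<forall>x\<in>Y. f x \<le> f y" by auto
  then show False using Y by fastforce
qed

text \<open>
  Compactness and connectedness are used only to see that the range of \<open>f\<close> is a densely ordered set
  with end points. If \<open>g (f x) < c \<le> 1\<close>, density of the range of \<open>g\<close> gives \<open>y\<close> with
  \<open>g (f x) < g (f y) < c\<close>, and the open set \<open>{f < f y}\<close> is a neighbourhood of \<open>x\<close> on which
  \<open>g \<circ> f < c\<close>; the other side is symmetric.
\<close>

lemma pseudo_continuous_imp_continuous_transform:
  assumes f: "pseudo_continuous Z f" and Z: "compact_space Z" "connected_space Z" "topspace Z \<noteq> {}"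
  obtains g :: "real \<Rightarrow> real" where "strict_mono_on (f ` topspace Z) g"
    "continuous_map Z euclideanreal (\<lambda>x. g (f x))"
proof -
  have up: "upper_pseudo_continuous Z f" and lo: "lower_pseudo_continuous Z f"
    using f by (auto simp: pseudo_continuous_def)
  let ?S = "f ` topspace Z"
  obtain v where v: "v \<in> topspace Z" "\<And>x. x \<in> topspace Z \<Longrightarrow> f x \<le> f v"
    using upper_pseudo_continuous_attains_max[OF up Z(1,3)] by blast
  obtain u where u: "u \<in> topspace Z" "\<And>x. x \<in> topspace Z \<Longrightarrow> f u \<le> f x"
    using upper_pseudo_continuous_attains_max[of Z "\<lambda>x. - f x"] lo Z
    by (auto simp: lower_pseudo_continuous_def)
  show thesis
  proof (cases "f u < f v")
    case False
    then have eq: "f x = f u" if "x \<in> topspace Z" for x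
      using u v that by (meson antisym leI order_trans)
    have "continuous_map Z euclideanreal (\<lambda>x. f u)" by simp
    then have "continuous_map Z euclideanreal f"
      using eq by (metis (mono_tags, lifting) continuous_map_eq)
    then show thesis using that[of "\<lambda>x. x"] by (auto simp: strict_mono_on_def)
  next
    case True
    \<comment> \<open>Two consecutive values would split \<open>Z\<close> into two open parts.\<close>
    have dense: "\<exists>t\<in>?S. s < t \<and> t < s'" if "s \<in> ?S" "s' \<in> ?S" "s < s'" for s s'
    proof (rule ccontr)
      assume no: "\<not> ?thesis"
      from that obtain x y where xy: "x \<in> topspace Z" "y \<in> topspace Z" "s = f x" "s' = f y"
        by blast
      let ?A = "{z \<in> topspace Z. f z < f y}" and ?B = "{z \<in> topspace Z. f z > f x}"
      have "openin Z ?A" "openin Z ?B"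
        using openin_pseudo_lower[OF up] openin_pseudo_upper[OF lo] xy by auto
      moreover have "topspace Z \<subseteq> ?A \<union> ?B" using that xy by auto
      moreover have "?A \<inter> ?B = {}" using no xy by auto
      moreover have "?A \<noteq> {}" "?B \<noteq> {}" using that xy by auto
      ultimately show False using Z(2) unfolding connected_space_def by blast
    qed
    obtain g :: "real \<Rightarrow> real" where g: "strict_mono_on ?S g" "g ` ?S \<subseteq> {0..1}"
      and gap: "\<And>x y. 0 \<le> x \<Longrightarrow> x < y \<Longrightarrow> y \<le> 1 \<Longrightarrow> \<exists>s\<in>?S. x < g s \<and> g s < y"
    proof (rule dense_order_embedding[of ?S "f u" "f v"])
      show "?S \<subseteq> {f u..f v}" using u v by auto
    qed (use dense u v True in auto)
    have g_less: "g (f x) < g (f y) \<longleftrightarrow> f x < f y" if "x \<in> topspace Z" "y \<in> topspace Z" for x y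
      using strict_mono_on_less[OF g(1)] that by simp
    have g01: "0 \<le> g (f x)" "g (f x) \<le> 1" if "x \<in> topspace Z" for x
      using g(2) that by (auto simp: image_subset_iff)
    have "continuous_map Z euclideanreal (\<lambda>x. g (f x))"
      unfolding continuous_map_upper_lower_semicontinuous_lt
    proof (intro conjI allI; subst openin_subopen, safe)
      fix c x assume x: "x \<in> topspace Z" "c < g (f x)"
      show "\<exists>T. openin Z T \<and> x \<in> T \<and> T \<subseteq> {x \<in> topspace Z. c < g (f x)}"
      proof (cases "c < 0")
        case True
        then show ?thesis using x g01 by (intro exI[of _ "topspace Z"]) force
      next
        case False
        then obtain y where y: "y \<in> topspace Z" "c < g (f y)" "g (f y) < g (f x)"
          using gap[of c "g (f x)"] x g01 by auto
        show ?thesis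
          using openin_pseudo_upper[OF lo y(1)] x y g_less
          by (intro exI[of _ "{z \<in> topspace Z. f y < f z}"]) force
      qed
    next
      fix c x assume x: "x \<in> topspace Z" "g (f x) < c"
      show "\<exists>T. openin Z T \<and> x \<in> T \<and> T \<subseteq> {x \<in> topspace Z. g (f x) < c}"
      proof (cases "c > 1")
        case True
        then show ?thesis using x g01 by (intro exI[of _ "topspace Z"]) force
      next
        case False
        then obtain y where y: "y \<in> topspace Z" "g (f x) < g (f y)" "g (f y) < c"
          using gap[of "g (f x)" c] x g01 by auto
        show ?thesis
          using openin_pseudo_lower[OF up y(1)] x y g_less
          by (intro exI[of _ "{z \<in> topspace Z. f z < f y}"]) force
      qed
    qed
    then show thesis using that g(1) by blast
  qed
qed

lemma continuous_imp_pseudo_continuous: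
  assumes "continuous_map Z euclideanreal f"
  shows "pseudo_continuous Z f"
proof -
  have "upper_pseudo_continuous Z h" if "continuous_map Z euclideanreal h" for h
    using that unfolding continuous_map_upper_lower_semicontinuous_lt upper_pseudo_continuous_def
    by (metis (mono_tags, lifting) mem_Collect_eq)
  then show ?thesis
    using assms continuous_map_minus[OF assms]
    by (auto simp: pseudo_continuous_def lower_pseudo_continuous_def)
qed

section \<open>Changing the scale of the payoffs in a Nash game\<close>

lemma convex_imp_connectedin:
  assumes T: "hausdorff_lctvs T" and C: "convex C" "C \<subseteq> topspace T"
  shows "connectedin T C"
proof -
  have "\<exists>S. connectedin (subtopology T C) S \<and> x \<in> S \<and> y \<in> S" if xy: "x \<in> C" "y \<in> C" for x y
  proof -
    let ?g = "\<lambda>t::real. (1 - t) *\<^sub>R x + t *\<^sub>R y"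
    have add: "continuous_map (prod_topology T T) T (\<lambda>(x, y). x + y)"
      and scale: "continuous_map (prod_topology euclideanreal T) T (\<lambda>(a, x). a *\<^sub>R x)"
      using T by (auto simp: hausdorff_lctvs_def)
    have mult: "continuous_map euclideanreal T (\<lambda>t. h t *\<^sub>R z)"
      if "z \<in> C" "continuous_map euclideanreal euclideanreal h" for h z
    proof -
      have "continuous_map euclideanreal (prod_topology euclideanreal T) (\<lambda>t. (h t, z))"
        using that C by (intro continuous_map_pairedI) auto
      from continuous_map_compose[OF this scale] show ?thesis by (simp add: o_def)
    qed
    have "continuous_map euclideanreal (prod_topology T T) (\<lambda>t. ((1 - t) *\<^sub>R x, t *\<^sub>R y))"
      using xy by (intro continuous_map_pairedI mult) (auto intro: continuous_intros)
    from continuous_map_compose[OF this add] have "continuous_map euclideanreal T ?g"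
      by (simp add: o_def)
    then have "connectedin T (?g ` {0..1})"
      by (rule connectedin_continuous_map_image) simp
    moreover have "?g ` {0..1} \<subseteq> C" using C(1) xy by (auto simp: convex_def)
    ultimately have "connectedin (subtopology T C) (?g ` {0..1})"
      by (simp add: connectedin_subtopology)
    moreover have "x \<in> ?g ` {0..1}" by (rule image_eqI[of _ _ 0]) auto
    moreover have "y \<in> ?g ` {0..1}" by (rule image_eqI[of _ _ 1]) auto
    ultimately show ?thesis by blast
  qed
  then have "connected_space (subtopology T C)"
    by (simp add: connected_space_subconnected)
  then show ?thesis using C(2) by (simp add: connectedin_def)
qed

text \<open>
  A superlevel set of the new payoff need not be a superlevel set of the old one, since the level
  \<open>c\<close> need not be a value of \<open>g\<close>. But it is closed upwards in the order of payoffs, so the convex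
  superlevel set of the old payoff at the worse of two of its points is contained in it.
\<close>

lemma quasi_concave_own_transform:
  assumes f: "quasi_concave_own p C i f" and i: "i \<in> {1..p}" and C: "convex (C i)"
    and g: "strict_mono_on (f ` strategies p C) g"
  shows "quasi_concave_own p C i (\<lambda>x. g (f x))"
  unfolding quasi_concave_own_def
proof (intro ballI allI)
  fix z c assume z: "z \<in> (\<Pi>\<^sub>E j\<in>{1..p} - {i}. C j)"
  let ?F = "\<lambda>y. f (z(i := y))"
  let ?L = "{y \<in> C i. c \<le> g (?F y)}"
  have "z(i := y) \<in> strategies p C" if "y \<in> C i" for y
    using z i that unfolding strategies_def by (auto simp: PiE_iff extensional_def)
  then have g_le: "?F x \<le> ?F y \<longleftrightarrow> g (?F x) \<le> g (?F y)" if "x \<in> C i" "y \<in> C i" for x y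
    using strict_mono_on_less_eq[OF g] that by simp
  have *: "r *\<^sub>R x + s *\<^sub>R y \<in> ?L"
    if "x \<in> ?L" "y \<in> ?L" "0 \<le> r" "0 \<le> s" "r + s = 1" for x y and r s :: real
  proof -
    define m where "m = (if ?F x \<le> ?F y then x else y)"
    have m: "m \<in> ?L" "?F m \<le> ?F x" "?F m \<le> ?F y" using that by (auto simp: m_def)
    have "convex {w \<in> C i. ?F m \<le> ?F w}"
      using f z unfolding quasi_concave_own_def by blast
    from convexD[OF this, of x y r s] have "r *\<^sub>R x + s *\<^sub>R y \<in> C i"
      "?F m \<le> ?F (r *\<^sub>R x + s *\<^sub>R y)" using that m by auto
    then show ?thesis using g_le[of m] m by auto
  qed
  show "convex ?L" unfolding convex_def using * by blast
qed

lemma strategy_topology_properties: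
  assumes "nash_game p E C"
    and "\<forall>i\<in>{1..p}. compactin (E i) (C i) \<and> convex (C i) \<and> C i \<noteq> {}"
  shows "topspace (strategy_topology p E C) = strategies p C" "strategies p C \<noteq> {}"
    "compact_space (strategy_topology p E C)" "connected_space (strategy_topology p E C)"
proof -
  have C: "hausdorff_lctvs (E i)" "C i \<subseteq> topspace (E i)" if "i \<in> {1..p}" for i
    using assms(1) that by (auto simp: nash_game_def)
  show "topspace (strategy_topology p E C) = strategies p C"
    unfolding strategy_topology_def strategies_def topspace_product_topology
    using C(2) by (intro PiE_cong) auto
  show "strategies p C \<noteq> {}"
    using assms(2) by (auto simp: strategies_def PiE_eq_empty_iff)
  show "compact_space (strategy_topology p E C)"
    using assms(2) unfolding strategy_topology_def
    by (auto simp: compact_space_product_topology compact_space_subtopology)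
  have "connected_space (subtopology (E i) (C i))" if "i \<in> {1..p}" for i
    using convex_imp_connectedin[OF C(1)[OF that] _ C(2)[OF that]] assms(2) that by (auto simp: connectedin_def)
  then show "connected_space (strategy_topology p E C)"
    unfolding strategy_topology_def by (auto simp: connected_space_product_topology)
qed

lemma nash_equilibrium_transform:
  assumes g: "\<And>i. i \<in> {1..p} \<Longrightarrow> strict_mono_on (\<theta> i ` strategies p C) (g i)"
  shows "nash_equilibrium p C (\<lambda>i x. g i (\<theta> i x)) x \<longleftrightarrow> nash_equilibrium p C \<theta> x"
proof -
  have "g i (\<theta> i (x(i := y))) \<le> g i (\<theta> i x) \<longleftrightarrow> \<theta> i (x(i := y)) \<le> \<theta> i x"
    if "x \<in> strategies p C" "i \<in> {1..p}" "y \<in> C i" for i y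
  proof -
    have "x(i := y) \<in> strategies p C"
      using that unfolding strategies_def by (auto simp: PiE_iff extensional_def)
    then show ?thesis using strict_mono_on_less_eq[OF g[OF that(2)]] that by simp
  qed
  then show ?thesis unfolding nash_equilibrium_def by blast
qed

theorem mainTheorem8:
  "(\<forall>p (E :: nat \<Rightarrow> 'e::real_vector topology) C (\<theta> :: nat \<Rightarrow> (nat \<Rightarrow> 'e) \<Rightarrow> real).
      nash_game p E C \<and>
      (\<forall>i\<in>{1..p}. compactin (E i) (C i) \<and> convex (C i) \<and> C i \<noteq> {} \<and>
         continuous_map (strategy_topology p E C) euclideanreal (\<theta> i) \<and>
         quasi_concave_own p C i (\<theta> i)) \<longrightarrow>
      (\<exists>x. nash_equilibrium p C \<theta> x))
   \<longleftrightarrow>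
   (\<forall>p (E :: nat \<Rightarrow> 'e topology) C (\<theta> :: nat \<Rightarrow> (nat \<Rightarrow> 'e) \<Rightarrow> real).
      nash_game p E C \<and>
      (\<forall>i\<in>{1..p}. compactin (E i) (C i) \<and> convex (C i) \<and> C i \<noteq> {} \<and>
         pseudo_continuous (strategy_topology p E C) (\<theta> i) \<and>
         quasi_concave_own p C i (\<theta> i)) \<longrightarrow>
      (\<exists>x. nash_equilibrium p C \<theta> x))"
  (is "?A \<longleftrightarrow> ?B")
proof
  assume A: ?A
  show ?B
  proof (intro allI impI, elim conjE)
    fix p and E :: "nat \<Rightarrow> 'e topology" and C and \<theta> :: "nat \<Rightarrow> (nat \<Rightarrow> 'e) \<Rightarrow> real"
    assume game: "nash_game p E C"
      and hyp: "\<forall>i\<in>{1..p}. compactin (E i) (C i) \<and> convex (C i) \<and> C i \<noteq> {} \<and>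
         pseudo_continuous (strategy_topology p E C) (\<theta> i) \<and> quasi_concave_own p C i (\<theta> i)"
    let ?Z = "strategy_topology p E C"
    have Z: "topspace ?Z = strategies p C" "strategies p C \<noteq> {}"
      "compact_space ?Z" "connected_space ?Z"
      using strategy_topology_properties[OF game] hyp by blast+
    have "\<forall>i\<in>{1..p}. \<exists>g :: real \<Rightarrow> real. strict_mono_on (\<theta> i ` strategies p C) g \<and>
        continuous_map ?Z euclideanreal (\<lambda>x. g (\<theta> i x))"
      using pseudo_continuous_imp_continuous_transform[OF _ Z(3,4)] hyp Z(1,2) by metis
    then obtain g :: "nat \<Rightarrow> real \<Rightarrow> real"
      where g: "\<And>i. i \<in> {1..p} \<Longrightarrow> strict_mono_on (\<theta> i ` strategies p C) (g i)"
        and cont: "\<And>i. i \<in> {1..p} \<Longrightarrow> continuous_map ?Z euclideanreal (\<lambda>x. g i (\<theta> i x))"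
      by metis
    have "quasi_concave_own p C i (\<lambda>x. g i (\<theta> i x))" if "i \<in> {1..p}" for i
      using quasi_concave_own_transform[OF _ that _ g[OF that]] hyp that by blast
    then have "\<exists>x. nash_equilibrium p C (\<lambda>i x. g i (\<theta> i x)) x"
      using A[rule_format, of p E C "\<lambda>i x. g i (\<theta> i x)"] game hyp cont by blast
    then show "\<exists>x. nash_equilibrium p C \<theta> x"
      using nash_equilibrium_transform[where g = g and \<theta> = \<theta>, OF g] by blast
  qed
next
  assume ?B
  then show ?A using continuous_imp_pseudo_continuous by blast
qed

end
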